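(* Let $(\mathcal{X},d)$ be a metric space, let $f,g:\mathcal{X}\to\mathcal{X}$ be maps and $F,G:\mathcal{X}\to\mathcal{P}_{fb}(\mathcal{X})$ be set-valued maps such that the pairs $\{f,F\}$ and $\{g,G\}$ are occasionally weakly compatible. Let $\Psi:\mathbb{R}^+\to\mathbb{R}^+$ be a nondecreasing map such that $\Psi(t)<t$ for every $t>0$, and let $0<a\le 1$, $0<\alpha,\beta\le 1$ and $p\ge 1$. Suppose that for all $x,y\in\mathcal{X}$, $$\begin{aligned}\delta^{p}(Fx,Gy)\le \Psi\Big[&a\,d^{p}(fx,gy)+(1-a)\max\Big\{\alpha\, d^{p}(fx,Fx),\ \beta\, d^{p}(gy,Gy),\ d^{\frac p2}(fx,Fx)\,d^{\frac p2}(gy,Fx),\\ & d^{\frac p2}(gy,Fx)\,d^{\frac p2}(fx,Gy),\ \tfrac12\big(d^{p}(fx,Fx)+d^{p}(gy,Gy)\big)\Big\}\Big].\end{aligned}$$ Then $f$, $g$, $F$ and $G$ have a unique common fixed point.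
   Context: $\mathcal{P}_{fb}(\mathcal{X})$ is the class of all nonempty bounded closed subsets of $\mathcal{X}$. $\mathbb{R}^+=[0,\infty)$. We write $fx=f(x)$, $Fx=F(x)$, and for $x\in\mathcal{X}$, $A,B\subseteq\mathcal{X}$, $d(x,A)=\inf\{d(x,y):y\in A\}$ and $\delta(A,B)=\sup\{d(a,b):a\in A,\,b\in B\}$; $d^p(\cdot,\cdot)$ and $\delta^p(\cdot,\cdot)$ denote $p$-th powers. A pair $\{f,F\}$ with $f:\mathcal{X}\to\mathcal{X}$ and $F:\mathcal{X}\to\mathcal{P}_{fb}(\mathcal{X})$ is occasionally weakly compatible (owc) if there exists $x\in\mathcal{X}$ such that $fx\in Fx$ and $fFx\subseteq Ffx$, where $fFx=\{f(y):y\in F(x)\}$ and $Ffx=F(f(x))$. A common fixed point of $f,g,F,G$ is a point $w\in\mathcal{X}$ with $w=fw=gw$, $w\in Fw$ and $w\in Gw$. *)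

theory Defs
  imports "HOL-Analysis.Analysis"
begin

definition P_fb :: "'a::metric_space set set" where
  "P_fb = {A. A \<noteq> {} \<and> bounded A \<and> closed A}"

(* The point-to-set distance d(x, A) is the library's infdist (the infimum for A nonempty;
   infdist_def sets it to 0 for A empty, which never occurs for values in P_fb).
   The supremum below is a real supremum: meaningful for nonempty bounded A and B. *)
definition set_delta :: "'a::metric_space set \<Rightarrow> 'a set \<Rightarrow> real" where
  "set_delta A B = Sup {dist a b | a b. a \<in> A \<and> b \<in> B}"

definition occasionally_weakly_compatible :: "('a \<Rightarrow> 'a) \<Rightarrow> ('a \<Rightarrow> 'a set) \<Rightarrow> bool" where
  "occasionally_weakly_compatible f F \<longleftrightarrow> (\<exists>x. f x \<in> F x \<and> f ` F x \<subseteq> F (f x))"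

definition common_fixed_point ::
    "('a \<Rightarrow> 'a) \<Rightarrow> ('a \<Rightarrow> 'a) \<Rightarrow> ('a \<Rightarrow> 'a set) \<Rightarrow> ('a \<Rightarrow> 'a set) \<Rightarrow> 'a \<Rightarrow> bool" where
  "common_fixed_point f g F G w \<longleftrightarrow> w = f w \<and> w = g w \<and> w \<in> F w \<and> w \<in> G w"

end

theory Submission
  imports Defs
begin

text \<open>If \<open>f x \<in> F x\<close> and \<open>g y \<in> G y\<close>, then every term of the maximum is at most
  \<open>D = dist (f x) (g y) powr p\<close>, so \<open>D \<le> \<Psi> D\<close>, which forces \<open>f x = g y\<close>. Weak compatibility
  turns a coincidence point \<open>x\<close> of \<open>f\<close> and \<open>F\<close> into the further coincidence point \<open>f x\<close>; comparing
  these with the corresponding points of \<open>g\<close> and \<open>G\<close> yields the fixed point and its uniqueness.\<close>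

text \<open>Boundedness of \<open>A\<close> and \<open>B\<close> bounds the set of distances above,
  so its real \<open>Sup\<close> is an actual upper bound.\<close>

lemma dist_le_set_delta:
  assumes "bounded A" "bounded B" "a \<in> A" "b \<in> B"
  shows "dist a b \<le> set_delta A B"
proof -
  obtain e where "\<And>u v. u \<in> A \<union> B \<Longrightarrow> v \<in> A \<union> B \<Longrightarrow> dist u v \<le> e"
    using assms(1,2) bounded_Un bounded_two_points by metis
  then have "bdd_above {dist u v | u v. u \<in> A \<and> v \<in> B}"
    by (intro bdd_aboveI[of _ e]) auto
  then show ?thesis
    unfolding set_delta_def using assms by (intro cSup_upper) auto
qed

text \<open>The inclusion, applied to the element \<open>f x\<close> of \<open>F x\<close>, makes
  \<open>f x\<close> a second coincidence point.\<close>

lemma occasionally_weakly_compatibleE: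
  assumes "occasionally_weakly_compatible f F"
  obtains x where "f x \<in> F x" "f (f x) \<in> F (f x)"
  using assms unfolding occasionally_weakly_compatible_def by blast

theorem theorem3p2:
  fixes f g :: "'a::metric_space \<Rightarrow> 'a"
    and F G :: "'a \<Rightarrow> 'a set"
    and \<Psi> :: "real \<Rightarrow> real"
    and a \<alpha> \<beta> p :: real
  assumes "\<And>x. F x \<in> P_fb"
    and "\<And>x. G x \<in> P_fb"
    and "occasionally_weakly_compatible f F"
    and "occasionally_weakly_compatible g G"
    and "\<And>t. 0 \<le> t \<Longrightarrow> 0 \<le> \<Psi> t"
    and "mono_on {0..} \<Psi>"
    and "\<And>t. 0 < t \<Longrightarrow> \<Psi> t < t"
    and "0 < a" and "a \<le> 1"
    and "0 < \<alpha>" and "\<alpha> \<le> 1"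
    and "0 < \<beta>" and "\<beta> \<le> 1"
    and "1 \<le> p"
    and "\<And>x y. set_delta (F x) (G y) powr p \<le>
      \<Psi> (a * dist (f x) (g y) powr p
         + (1 - a) * Max {\<alpha> * infdist (f x) (F x) powr p,
                          \<beta> * infdist (g y) (G y) powr p,
                          infdist (f x) (F x) powr (p / 2) * infdist (g y) (F x) powr (p / 2),
                          infdist (g y) (F x) powr (p / 2) * infdist (f x) (G y) powr (p / 2),
                          1 / 2 * (infdist (f x) (F x) powr p + infdist (g y) (G y) powr p)})"
  shows "\<exists>!w. common_fixed_point f g F G w"
proof -
  have coincide: "f x = g y" if x: "f x \<in> F x" and y: "g y \<in> G y" for x y
  proof (rule ccontr)
    assume "f x \<noteq> g y"
    define d where "d = dist (f x) (g y)"
    define M where "M = Max {\<alpha> * infdist (f x) (F x) powr p,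
                          \<beta> * infdist (g y) (G y) powr p,
                          infdist (f x) (F x) powr (p / 2) * infdist (g y) (F x) powr (p / 2),
                          infdist (g y) (F x) powr (p / 2) * infdist (f x) (G y) powr (p / 2),
                          1 / 2 * (infdist (f x) (F x) powr p + infdist (g y) (G y) powr p)}"
    have "d > 0"
      using \<open>f x \<noteq> g y\<close> by (simp add: d_def)
    then have pos: "d powr p > 0"
      by simp
    have "infdist (g y) (F x) \<le> d" "infdist (f x) (G y) \<le> d"
      using infdist_le[OF x, of "g y"] infdist_le[OF y, of "f x"]
      by (simp_all add: d_def dist_commute)
    \<comment> \<open>Since \<open>infdist (f x) (F x)\<close> and
      \<open>infdist (g y) (G y)\<close> vanish and \<open>0 powr z = 0\<close>, this product is the
      only term of the maximum that can be nonzero.\<close>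
    then have "infdist (g y) (F x) powr (p / 2) * infdist (f x) (G y) powr (p / 2)
        \<le> d powr (p / 2) * d powr (p / 2)"
      using \<open>1 \<le> p\<close> by (intro mult_mono powr_mono2) (auto simp: infdist_nonneg)
    also have "\<dots> = d powr p"
      by (simp flip: powr_add)
    finally have "0 \<le> M" "M \<le> d powr p"
      using x y pos by (simp_all add: M_def le_max_iff_disj)
    \<comment> \<open>A convex combination of \<open>d powr p\<close> and \<open>M\<close>; its
      nonnegativity places it in \<open>{0..}\<close>, where \<open>\<Psi>\<close> is
      monotone.\<close>
    then have arg: "0 \<le> a * d powr p + (1 - a) * M" "a * d powr p + (1 - a) * M \<le> d powr p"
      using \<open>0 < a\<close> \<open>a \<le> 1\<close> pos
      by (auto intro: convex_bound_le)
    have "d \<le> set_delta (F x) (G y)"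
      unfolding d_def using assms(1)[of x] assms(2)[of y] x y
      by (intro dist_le_set_delta) (auto simp: P_fb_def)
    then have "d powr p \<le> set_delta (F x) (G y) powr p"
      using \<open>0 < d\<close> \<open>1 \<le> p\<close> by (intro powr_mono2) auto
    also have "\<dots> \<le> \<Psi> (a * d powr p + (1 - a) * M)"
      unfolding d_def M_def by (rule assms)
    also have "\<dots> \<le> \<Psi> (d powr p)"
      using arg by (intro mono_onD[OF \<open>mono_on {0..} \<Psi>\<close>]) auto
    also have "\<dots> < d powr p"
      using pos by (rule assms)
    finally show False
      by simp
  qed
  obtain x where x: "f x \<in> F x" "f (f x) \<in> F (f x)"
    using assms(3) by (rule occasionally_weakly_compatibleE)
  obtain y where y: "g y \<in> G y" "g (g y) \<in> G (g y)"
    using assms(4) by (rule occasionally_weakly_compatibleE)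
  \<comment> \<open>The pairs \<open>(x, y)\<close>, \<open>(f x, y)\<close> and
    \<open>(x, g y)\<close> in \<open>coincide\<close>; together they show that \<open>f\<close> and
    \<open>g\<close> both fix \<open>f x\<close>.\<close>
  have "f x = g y" "f (f x) = g y" "f x = g (g y)"
    using x y by (auto intro: coincide)
  then have "common_fixed_point f g F G (f x)"
    using x y unfolding common_fixed_point_def by metis
  \<comment> \<open>Common fixed points \<open>v\<close> and \<open>w\<close> satisfy
    \<open>v = f v \<in> F v\<close> and \<open>w = g w \<in> G w\<close>, so
    \<open>coincide\<close> gives \<open>v = w\<close>.\<close>
  then show ?thesis
    using coincide unfolding common_fixed_point_def by metis
qed

end
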